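(* Let $X$ be an order complete locally solid $f$-ring with unity and the Fatou property. Then $\mathsf{Hom}^{b}_{br}(X)$ has the Levi property if and only if $X$ has the Levi property.
   Context: An $\ell$-ring (lattice ring) is a ring which is also a lattice, the additive group being a lattice-ordered group, with $|x\cdot y|\le |x|\cdot|y|$ for all $x,y$. $X_+=\{x\in X: x\ge 0\}$. A set $S\subseteq X$ is solid if $x\in X$, $y\in S$, $|x|\le|y|$ imply $x\in S$. A locally solid $\ell$-ring is an $\ell$-ring that is also a topological ring and has a local basis at zero consisting of solid sets. An $f$-ring is an $\ell$-ring in which $a\wedge b=0$ and $c>0$ imply $ca\wedge b=ac\wedge b=0$; a locally solid $f$-ring is a locally solid $\ell$-ring that is an $f$-ring. Order complete: every non-empty subset that is bounded above has a supremum. A net $(x_\alpha)$ is order convergent to $x$ if there is a net $(z_\beta)$ (possibly over a different index set) with $z_\beta\downarrow 0$ such that for every $\beta$ there is $\alpha_0$ with $|x_\alpha-x|\le z_\beta$ for all $\alpha\ge\alpha_0$. A set is order closed if it contains the limits of all order convergent nets lying in it. $X$ has the Fatou property if its topology has a local basis at zero consisting of solid order closed neighborhoods. A set $B$ in a topological ring is bounded if for each zero neighborhood $W$ there is a zero neighborhood $V$ with $VB\subseteq W$ and $BV\subseteq W$ (sets of products). A locally solid $\ell$-ring has the Levi property if every bounded upward directed set of positive elements has a supremum. A group homomorphism $T:X\to X$ (of the additive group) is order bounded if it maps order bounded sets (sets contained in an order interval $[u,v]$) to order bounded sets, and $br$-bounded if $T(B)$ is bounded for every bounded $B\subseteq X$.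 $\mathsf{Hom}^{b}_{br}(X)$ is the set of all order bounded $br$-bounded group homomorphisms $X\to X$, with pointwise addition, composition as multiplication, the order $T\le S$ iff $T(x)\le S(x)$ for all $x\in X_+$ (lattice operations given by Riesz–Kantorovich formulae, in particular $|T|(x)=\sup\{|T(u)|:|u|\le x\}$ for $x\in X_+$), and the topology of uniform convergence on bounded sets: $S_\alpha\to S$ iff for each bounded $B\subseteq X$ and each zero neighborhood $V\subseteq X$ there is $\alpha_0$ with $(S_\alpha-S)(B)\subseteq V$ for all $\alpha\ge\alpha_0$. It is a locally solid $\ell$-ring. Standing assumption: in every topological group considered (including the additive groups of topological rings), singletons are bounded in the group sense: for each $x$ and each neighborhood $U$ of the identity there is a positive integer $n$ with $x\in nU=\{x_1+\dots+x_n: x_i\in U\}$. *)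

theory Defs
  imports Complex_Main "HOL-Library.Lattice_Algebras" "HOL-Library.Lub_Glb"
begin

section \<open>Neighbourhoods\<close>

definition (in topological_space) nbhd :: "'a \<Rightarrow> 'a set \<Rightarrow> bool"
  where "nbhd x N \<longleftrightarrow> (\<exists>U. open U \<and> x \<in> U \<and> U \<subseteq> N)"

definition (in topological_space) nbhd_basis :: "'a \<Rightarrow> 'a set set \<Rightarrow> bool"
  where "nbhd_basis x \<B> \<longleftrightarrow>
    (\<forall>V\<in>\<B>. nbhd x V) \<and> (\<forall>U. nbhd x U \<longrightarrow> (\<exists>V\<in>\<B>. V \<subseteq> U))"

lemma nbhd_iff_eventually: "nbhd x N \<longleftrightarrow> eventually (\<lambda>y. y \<in> N) (nhds x)"
  unfolding nbhd_def eventually_nhds by blast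

lemma nbhd_Int: "nbhd x M \<Longrightarrow> nbhd x N \<Longrightarrow> nbhd x (M \<inter> N)"
  unfolding nbhd_iff_eventually by (simp add: eventually_conj)

lemma nbhd_mem: "nbhd x N \<Longrightarrow> x \<in> N"
  unfolding nbhd_def by blast

lemma nbhd_UNIV: "nbhd x UNIV"
  by (simp add: nbhd_iff_eventually)

lemma nbhd_tendsto:
  assumes "(f \<longlongrightarrow> f x) (nhds x)" "nbhd (f x) W"
  shows "\<exists>V. nbhd x V \<and> f ` V \<subseteq> W"
proof -
  have "eventually (\<lambda>y. f y \<in> W) (nhds x)"
    using assms unfolding nbhd_iff_eventually filterlim_iff by (elim allE[where x = "\<lambda>y. y \<in> W"]) simp
  then have "nbhd x {y. f y \<in> W}" by (simp add: nbhd_iff_eventually)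
  then show ?thesis by (intro exI[of _ "{y. f y \<in> W}"]) auto
qed

lemma nbhd_zero_add:
  fixes W :: "'a::topological_monoid_add set"
  assumes "nbhd 0 W"
  obtains V where "nbhd 0 V" "\<forall>x\<in>V. \<forall>y\<in>V. x + y \<in> W"
proof -
  have "eventually (\<lambda>p. fst p + snd p \<in> W) (nhds (0::'a) \<times>\<^sub>F nhds 0)"
    using tendsto_add_Pair[of "0::'a" 0] assms
    unfolding nbhd_iff_eventually filterlim_iff add_0_left
    by (elim allE[where x = "\<lambda>y. y \<in> W"]) simp
  then obtain P Q where "eventually P (nhds (0::'a))" "eventually Q (nhds (0::'a))"
    and *: "\<And>x y. P x \<Longrightarrow> Q y \<Longrightarrow> x + y \<in> W"
    unfolding eventually_prod_filter by auto
  then have "nbhd 0 {x. P x \<and> Q x}"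
    by (simp add: nbhd_iff_eventually eventually_conj)
  then show thesis using * by (intro that[of "{x. P x \<and> Q x}"]) auto
qed


section \<open>Lattice-ordered rings\<close>

class l_ring = ring + lattice_ab_group_add_abs +
  assumes abs_mult_le: "\<bar>x * y\<bar> \<le> \<bar>x\<bar> * \<bar>y\<bar>"
begin

definition solid :: "'a set \<Rightarrow> bool"
  where "solid S \<longleftrightarrow> (\<forall>x y. y \<in> S \<and> \<bar>x\<bar> \<le> \<bar>y\<bar> \<longrightarrow> x \<in> S)"

lemma mult_nonneg: "0 \<le> x \<Longrightarrow> 0 \<le> y \<Longrightarrow> 0 \<le> x * y"
  using order_trans[OF abs_ge_zero abs_mult_le, of x y] by simp

subclass lattice_ring
proof
  fix a b c :: 'a
  assume "a \<le> b" "0 \<le> c"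
  then have ba: "0 \<le> b - a" by simp
  have "0 \<le> c * b - c * a"
    using mult_nonneg[OF \<open>0 \<le> c\<close> ba] unfolding right_diff_distrib .
  then show "c * a \<le> c * b" by (rule iffD1[OF diff_ge_0_iff_ge])
  have "0 \<le> b * c - a * c"
    using mult_nonneg[OF ba \<open>0 \<le> c\<close>] unfolding left_diff_distrib .
  then show "a * c \<le> b * c" by (rule iffD1[OF diff_ge_0_iff_ge])
qed

end

class locally_solid_l_ring = l_ring + topological_ab_group_add + topological_semigroup_mult +
  assumes locally_solid: "\<exists>\<B>. nbhd_basis 0 \<B> \<and> (\<forall>V\<in>\<B>. solid V)"

class locally_solid_f_ring = locally_solid_l_ring +
  assumes f_ring: "inf a b = 0 \<Longrightarrow> 0 < c \<Longrightarrow> inf (c * a) b = 0 \<and> inf (a * c) b = 0"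

definition order_complete :: "'a::order itself \<Rightarrow> bool"
  where "order_complete (_ :: 'a itself) \<longleftrightarrow>
    (\<forall>A :: 'a set. A \<noteq> {} \<and> bdd_above A \<longrightarrow> (\<exists>s. isLub UNIV A s))"

definition has_unity :: "'a::ring itself \<Rightarrow> bool"
  where "has_unity (_ :: 'a itself) \<longleftrightarrow> (\<exists>e :: 'a. \<forall>x. e * x = x \<and> x * e = x)"

text \<open>Boundedness of singletons in the sense of topological groups: every point is, for
  every zero neighbourhood \<open>U\<close>, a sum of finitely many (at least one) elements of \<open>U\<close>.\<close>

definition singletons_group_bounded :: "'a::topological_ab_group_add itself \<Rightarrow> bool"
  where "singletons_group_bounded (_ :: 'a itself) \<longleftrightarrow>
    (\<forall>(x :: 'a) U. nbhd 0 U \<longrightarrow> (\<exists>n>0. \<exists>u. (\<forall>i<n. u i \<in> U) \<and> x = (\<Sum>i<n::nat. u i)))"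


section \<open>Order convergence and the Fatou property\<close>

text \<open>A net is a function on a carrier \<open>I\<close> directed by a preorder \<open>r\<close>.\<close>

definition directed_index :: "'i set \<Rightarrow> ('i \<Rightarrow> 'i \<Rightarrow> bool) \<Rightarrow> bool"
  where "directed_index I r \<longleftrightarrow> I \<noteq> {} \<and> (\<forall>i\<in>I. r i i) \<and>
    (\<forall>i\<in>I. \<forall>j\<in>I. \<forall>k\<in>I. r i j \<longrightarrow> r j k \<longrightarrow> r i k) \<and>
    (\<forall>i\<in>I. \<forall>j\<in>I. \<exists>k\<in>I. r i k \<and> r j k)"

definition net_down_zero :: "'j set \<Rightarrow> ('j \<Rightarrow> 'j \<Rightarrow> bool) \<Rightarrow> ('j \<Rightarrow> 'a::l_ring) \<Rightarrow> bool"
  where "net_down_zero J s z \<longleftrightarrow> directed_index J s \<and>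
    (\<forall>i\<in>J. \<forall>j\<in>J. s i j \<longrightarrow> z j \<le> z i) \<and> isGlb UNIV (z ` J) 0"

definition net_dominated ::
  "'i set \<Rightarrow> ('i \<Rightarrow> 'i \<Rightarrow> bool) \<Rightarrow> ('i \<Rightarrow> 'a::l_ring) \<Rightarrow> 'a \<Rightarrow> 'j set \<Rightarrow> ('j \<Rightarrow> 'a) \<Rightarrow> bool"
  where "net_dominated I r x l J z \<longleftrightarrow>
    (\<forall>j\<in>J. \<exists>i0\<in>I. \<forall>i\<in>I. r i0 i \<longrightarrow> \<bar>x i - l\<bar> \<le> z j)"

text \<open>A definition cannot quantify over index types. The dominating net in
  \<open>order_convergent\<close> and the nets in \<open>order_closed\<close> are therefore indexed by subsets of the
  type \<open>'a\<close> itself; lemmas \<open>order_convergentI\<close> and \<open>order_closedD\<close> below show that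
  this gives the same notions as nets over arbitrary index types.\<close>

definition order_convergent ::
  "'i set \<Rightarrow> ('i \<Rightarrow> 'i \<Rightarrow> bool) \<Rightarrow> ('i \<Rightarrow> 'a::l_ring) \<Rightarrow> 'a \<Rightarrow> bool"
  where "order_convergent I r x l \<longleftrightarrow> directed_index I r \<and>
    (\<exists>(J :: 'a set) s z. net_down_zero J s z \<and> net_dominated I r x l J z)"

definition order_closed :: "'a::l_ring set \<Rightarrow> bool"
  where "order_closed S \<longleftrightarrow>
    (\<forall>(I :: 'a set) r x l. (\<forall>i\<in>I. x i \<in> S) \<and> order_convergent I r x l \<longrightarrow> l \<in> S)"

lemma order_convergentI:
  fixes z :: "'j \<Rightarrow> 'a::l_ring"
  assumes I: "directed_index I r" and z: "net_down_zero J s z" and d: "net_dominated I r x l J z"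
  shows "order_convergent I r x l"
proof -
  have zD: "directed_index J s" "\<And>i j. i \<in> J \<Longrightarrow> j \<in> J \<Longrightarrow> s i j \<Longrightarrow> z j \<le> z i"
    "isGlb UNIV (z ` J) 0"
    using z unfolding net_down_zero_def by blast+
  have dir: "\<exists>k\<in>J. z k \<le> z i \<and> z k \<le> z j" if ij: "i \<in> J" "j \<in> J" for i j
  proof -
    obtain k where "k \<in> J" "s i k" "s j k"
      using zD(1) ij unfolding directed_index_def by blast
    then show ?thesis using zD(2) ij by blast
  qed
  have "directed_index (z ` J) (\<lambda>a b. b \<le> a)"
    unfolding directed_index_def
  proof (intro conjI ballI impI)
    show "z ` J \<noteq> {}" using zD(1) unfolding directed_index_def by simp
    show "\<exists>c\<in>z ` J. c \<le> a \<and> c \<le> b" if "a \<in> z ` J" "b \<in> z ` J" for a b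
      using that dir by force
  qed auto
  then have "net_down_zero (z ` J) (\<lambda>a b. b \<le> a) (\<lambda>a. a)"
    using zD(3) unfolding net_down_zero_def by simp
  moreover have "net_dominated I r x l (z ` J) (\<lambda>a. a)"
    using d unfolding net_dominated_def by simp
  ultimately show ?thesis using I unfolding order_convergent_def by blast
qed

lemma order_closedD:
  fixes x :: "'i \<Rightarrow> 'a::l_ring"
  assumes S: "order_closed S" and x: "\<And>i. i \<in> I \<Longrightarrow> x i \<in> S" and c: "order_convergent I r x l"
  shows "l \<in> S"
proof -
  from c obtain J :: "'a set" and s z
    where I: "directed_index I r" and z: "net_down_zero J s z" and d: "net_dominated I r x l J z"
    unfolding order_convergent_def by auto
  have "\<forall>j\<in>J. \<exists>y\<in>S. \<bar>y - l\<bar> \<le> z j"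
  proof
    fix j assume "j \<in> J"
    then obtain i where i: "i \<in> I" "\<forall>k\<in>I. r i k \<longrightarrow> \<bar>x k - l\<bar> \<le> z j"
      using d unfolding net_dominated_def by blast
    moreover have "r i i" using I i(1) unfolding directed_index_def by blast
    ultimately show "\<exists>y\<in>S. \<bar>y - l\<bar> \<le> z j" using x by blast
  qed
  then obtain y where y: "\<And>j. j \<in> J \<Longrightarrow> y j \<in> S" "\<And>j. j \<in> J \<Longrightarrow> \<bar>y j - l\<bar> \<le> z j"
    by metis
  have "net_dominated J s y l J z"
    unfolding net_dominated_def
  proof
    fix j assume j: "j \<in> J"
    have "\<bar>y k - l\<bar> \<le> z j" if "k \<in> J" "s j k" for k
    proof -
      have "z k \<le> z j" using z j that unfolding net_down_zero_def by blast
      then show ?thesis using y(2)[OF that(1)] by (rule order_trans[rotated])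
    qed
    then show "\<exists>i0\<in>J. \<forall>i\<in>J. s i0 i \<longrightarrow> \<bar>y i - l\<bar> \<le> z j" using j by blast
  qed
  then have "order_convergent J s y l"
    using z unfolding order_convergent_def net_down_zero_def by blast
  then show ?thesis using S y(1) unfolding order_closed_def by blast
qed

definition fatou_property :: "'a::locally_solid_l_ring itself \<Rightarrow> bool"
  where "fatou_property (_ :: 'a itself) \<longleftrightarrow>
    (\<exists>\<B> :: 'a set set. nbhd_basis 0 \<B> \<and> (\<forall>V\<in>\<B>. solid V \<and> order_closed V))"


section \<open>Bounded sets and the Levi property\<close>

definition ring_bounded :: "'a::{zero,times,topological_space} set \<Rightarrow> bool"
  where "ring_bounded B \<longleftrightarrow>
    (\<forall>W. nbhd 0 W \<longrightarrow> (\<exists>V. nbhd 0 V \<and> (\<forall>v\<in>V. \<forall>b\<in>B. v * b \<in> W \<and> b * v \<in> W)))"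

definition upward_directed :: "'a::ord set \<Rightarrow> bool"
  where "upward_directed A \<longleftrightarrow> A \<noteq> {} \<and> (\<forall>a\<in>A. \<forall>b\<in>A. \<exists>c\<in>A. a \<le> c \<and> b \<le> c)"

text \<open>The sort only lists what the notion refers to, so that it applies both to locally solid
  lattice-ordered rings and to the ring of operators defined below.\<close>

definition levi_property :: "'a::{zero,times,order,topological_space} itself \<Rightarrow> bool"
  where "levi_property (_ :: 'a itself) \<longleftrightarrow>
    (\<forall>A :: 'a set. ring_bounded A \<and> upward_directed A \<and> (\<forall>a\<in>A. 0 \<le> a) \<longrightarrow>
      (\<exists>s. isLub UNIV A s))"

lemma ring_bounded_subset:
  fixes B :: "'a::{zero,times,topological_space} set"
  shows "ring_bounded B \<Longrightarrow> A \<subseteq> B \<Longrightarrow> ring_bounded A"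
proof -
  assume B: "ring_bounded B" and sub: "A \<subseteq> B"
  show "ring_bounded A"
    unfolding ring_bounded_def
  proof (intro allI impI)
    fix W :: "'a set" assume "nbhd 0 W"
    then obtain V where "nbhd 0 V" "\<forall>v\<in>V. \<forall>b\<in>B. v * b \<in> W \<and> b * v \<in> W"
      using B unfolding ring_bounded_def by auto
    then show "\<exists>V. nbhd 0 V \<and> (\<forall>v\<in>V. \<forall>b\<in>A. v * b \<in> W \<and> b * v \<in> W)"
      using sub by (intro exI[of _ V]) auto
  qed
qed

lemma ring_bounded_empty: "ring_bounded {}"
  unfolding ring_bounded_def by (auto intro!: exI[of _ UNIV] nbhd_UNIV)

lemma ring_bounded_Un:
  assumes "ring_bounded A" "ring_bounded B"
  shows "ring_bounded (A \<union> B)"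
  unfolding ring_bounded_def
proof (intro allI impI)
  fix W :: "'a set" assume W: "nbhd 0 W"
  obtain V1 where V1: "nbhd 0 V1" "\<forall>v\<in>V1. \<forall>b\<in>A. v * b \<in> W \<and> b * v \<in> W"
    using assms(1) W unfolding ring_bounded_def by blast
  obtain V2 where V2: "nbhd 0 V2" "\<forall>v\<in>V2. \<forall>b\<in>B. v * b \<in> W \<and> b * v \<in> W"
    using assms(2) W unfolding ring_bounded_def by blast
  show "\<exists>V. nbhd 0 V \<and> (\<forall>v\<in>V. \<forall>b\<in>A \<union> B. v * b \<in> W \<and> b * v \<in> W)"
    using V1 V2 by (intro exI[of _ "V1 \<inter> V2"]) (auto intro: nbhd_Int)
qed

lemma ring_bounded_zero: "ring_bounded {0 :: 'a::{ring,topological_space}}"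
  unfolding ring_bounded_def by (auto intro!: exI[of _ UNIV] nbhd_UNIV dest: nbhd_mem)

lemma ring_bounded_add:
  fixes A B :: "'a::locally_solid_l_ring set"
  assumes "ring_bounded A" "ring_bounded B"
  shows "ring_bounded {a + b | a b. a \<in> A \<and> b \<in> B}"
  unfolding ring_bounded_def
proof (intro allI impI)
  fix W :: "'a set" assume "nbhd 0 W"
  then obtain U where U: "nbhd 0 U" "\<forall>x\<in>U. \<forall>y\<in>U. x + y \<in> W"
    by (rule nbhd_zero_add)
  obtain V where "nbhd 0 V" "\<forall>v\<in>V. \<forall>b\<in>A \<union> B. v * b \<in> U \<and> b * v \<in> U"
    using ring_bounded_Un[OF assms] U(1) unfolding ring_bounded_def by blast
  then show "\<exists>V. nbhd 0 V \<and>
      (\<forall>v\<in>V. \<forall>c\<in>{a + b | a b. a \<in> A \<and> b \<in> B}. v * c \<in> W \<and> c * v \<in> W)"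
    by (intro exI[of _ V]) (auto simp: distrib_left distrib_right U(2))
qed

lemma ring_bounded_uminus:
  fixes A :: "'a::locally_solid_l_ring set"
  assumes "ring_bounded A"
  shows "ring_bounded (uminus ` A)"
  unfolding ring_bounded_def
proof (intro allI impI)
  fix W :: "'a set" assume "nbhd 0 W"
  then obtain U where U: "nbhd 0 U" "uminus ` U \<subseteq> W"
    using nbhd_tendsto[of uminus "0::'a" W] tendsto_uminus_nhds[of "0::'a"] by auto
  obtain V where "nbhd 0 V" "\<forall>v\<in>V. \<forall>b\<in>A. v * b \<in> U \<and> b * v \<in> U"
    using assms U(1) unfolding ring_bounded_def by blast
  then show "\<exists>V. nbhd 0 V \<and> (\<forall>v\<in>V. \<forall>c\<in>uminus ` A. v * c \<in> W \<and> c * v \<in> W)"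
    using U(2) by (intro exI[of _ V]) auto
qed


section \<open>Order bounded br-bounded group homomorphisms\<close>

definition order_bounded_set :: "'a::order set \<Rightarrow> bool"
  where "order_bounded_set A \<longleftrightarrow> (\<exists>u v. A \<subseteq> {u..v})"

definition order_bounded_map :: "('a::order \<Rightarrow> 'a) \<Rightarrow> bool"
  where "order_bounded_map T \<longleftrightarrow> (\<forall>A. order_bounded_set A \<longrightarrow> order_bounded_set (T ` A))"

definition br_bounded_map :: "('a::{zero,times,topological_space} \<Rightarrow> 'a) \<Rightarrow> bool"
  where "br_bounded_map T \<longleftrightarrow> (\<forall>B. ring_bounded B \<longrightarrow> ring_bounded (T ` B))"

definition br_homs :: "('a::locally_solid_l_ring \<Rightarrow> 'a) set"
  where "br_homs = {T. additive T \<and> order_bounded_map T \<and> br_bounded_map T}"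

lemma br_homs_zero: "(\<lambda>_::'a::locally_solid_l_ring. 0) \<in> br_homs"
proof -
  have "order_bounded_set ((\<lambda>_. 0 :: 'a) ` A)" for A :: "'a set"
    unfolding order_bounded_set_def by (intro exI[of _ 0]) auto
  moreover have "ring_bounded ((\<lambda>_. 0 :: 'a) ` B)" for B :: "'a set"
    by (rule ring_bounded_subset[OF ring_bounded_zero]) auto
  ultimately show ?thesis
    unfolding br_homs_def order_bounded_map_def br_bounded_map_def additive_def by simp
qed

lemma br_homs_add:
  assumes "S \<in> br_homs" "T \<in> br_homs"
  shows "(\<lambda>x. S x + T x) \<in> br_homs"
proof -
  have "order_bounded_set ((\<lambda>x. S x + T x) ` A)" if "order_bounded_set A" for A
  proof -
    have "order_bounded_set (S ` A)" "order_bounded_set (T ` A)"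
      using assms that unfolding br_homs_def order_bounded_map_def by auto
    then obtain u v u' v' where "S ` A \<subseteq> {u..v}" "T ` A \<subseteq> {u'..v'}"
      unfolding order_bounded_set_def by auto
    then show ?thesis unfolding order_bounded_set_def
      by (intro exI[of _ "u + u'"] exI[of _ "v + v'"])
        (auto simp: image_subset_iff intro: add_mono)
  qed
  moreover have "ring_bounded ((\<lambda>x. S x + T x) ` B)" if "ring_bounded B" for B
  proof -
    have "ring_bounded (S ` B)" "ring_bounded (T ` B)"
      using assms that unfolding br_homs_def br_bounded_map_def by auto
    then show ?thesis by (rule ring_bounded_subset[OF ring_bounded_add]) auto
  qed
  moreover have "additive (\<lambda>x. S x + T x)"
    using assms unfolding br_homs_def additive_def by (simp add: algebra_simps)
  ultimately show ?thesis
    unfolding br_homs_def order_bounded_map_def br_bounded_map_def by simp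
qed

lemma br_homs_uminus:
  assumes "T \<in> br_homs"
  shows "(\<lambda>x. - T x) \<in> br_homs"
proof -
  have "order_bounded_set ((\<lambda>x. - T x) ` A)" if "order_bounded_set A" for A
  proof -
    have "order_bounded_set (T ` A)"
      using assms that unfolding br_homs_def order_bounded_map_def by auto
    then obtain u v where "T ` A \<subseteq> {u..v}"
      unfolding order_bounded_set_def by auto
    then show ?thesis unfolding order_bounded_set_def
      by (intro exI[of _ "- v"] exI[of _ "- u"]) (auto simp: image_subset_iff)
  qed
  moreover have "ring_bounded ((\<lambda>x. - T x) ` B)" if "ring_bounded B" for B
  proof -
    have "ring_bounded (T ` B)"
      using assms that unfolding br_homs_def br_bounded_map_def by auto
    then show ?thesis by (rule ring_bounded_subset[OF ring_bounded_uminus]) auto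
  qed
  moreover have "additive (\<lambda>x. - T x)"
    using assms unfolding br_homs_def additive_def by simp
  ultimately show ?thesis
    unfolding br_homs_def order_bounded_map_def br_bounded_map_def by simp
qed

lemma br_homs_comp:
  assumes "S \<in> br_homs" "T \<in> br_homs"
  shows "S \<circ> T \<in> br_homs"
proof -
  have "order_bounded_set ((S \<circ> T) ` A)" if "order_bounded_set A" for A
    using assms that unfolding image_comp[symmetric] br_homs_def order_bounded_map_def by blast
  moreover have "ring_bounded ((S \<circ> T) ` B)" if "ring_bounded B" for B
    using assms that unfolding image_comp[symmetric] br_homs_def br_bounded_map_def by blast
  moreover have "additive (S \<circ> T)"
    using assms unfolding br_homs_def additive_def by simp
  ultimately show ?thesis
    unfolding br_homs_def order_bounded_map_def br_bounded_map_def by simp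
qed

typedef (overloaded) 'a br_hom = "br_homs :: ('a::locally_solid_l_ring \<Rightarrow> 'a) set"
  morphisms br_apply Abs_br_hom
  using br_homs_zero by blast

lemma br_hom_eqI: "(\<And>x. br_apply S x = br_apply T x) \<Longrightarrow> S = T"
  by (rule iffD1[OF br_apply_inject]) (rule ext)

lemma br_apply_add_right: "br_apply T (x + y) = br_apply T x + br_apply T y"
  using br_apply[of T] by (simp add: br_homs_def additive.add)

lemma br_apply_minus_right: "br_apply T (x - y) = br_apply T x - br_apply T y"
  using br_apply[of T] by (simp add: br_homs_def additive.diff)

instantiation br_hom :: (locally_solid_l_ring) ring
begin

definition zero_br_hom_def: "0 = Abs_br_hom (\<lambda>_. 0)"
definition plus_br_hom_def: "S + T = Abs_br_hom (\<lambda>x. br_apply S x + br_apply T x)"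
definition uminus_br_hom_def: "- T = Abs_br_hom (\<lambda>x. - br_apply T x)"
definition minus_br_hom_def: "S - T = S + - (T :: 'a br_hom)"
definition times_br_hom_def: "S * T = Abs_br_hom (br_apply S \<circ> br_apply T)"

lemma br_apply_zero: "br_apply 0 x = 0"
  by (simp add: zero_br_hom_def Abs_br_hom_inverse br_homs_zero)

lemma br_apply_plus: "br_apply (S + T) x = br_apply S x + br_apply T x"
  by (simp add: plus_br_hom_def Abs_br_hom_inverse br_homs_add br_apply)

lemma br_apply_uminus: "br_apply (- T) x = - br_apply T x"
  by (simp add: uminus_br_hom_def Abs_br_hom_inverse br_homs_uminus br_apply)

lemma br_apply_minus: "br_apply (S - T) x = br_apply S x - br_apply T x"
  by (simp add: minus_br_hom_def br_apply_plus br_apply_uminus)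

lemma br_apply_times: "br_apply (S * T) x = br_apply S (br_apply T x)"
  by (simp add: times_br_hom_def Abs_br_hom_inverse br_homs_comp br_apply)

instance
  by standard
    (rule br_hom_eqI; simp add: br_apply_zero br_apply_plus br_apply_uminus br_apply_minus
      br_apply_times br_apply_add_right add_ac)+

end

instantiation br_hom :: (locally_solid_l_ring) ordered_ab_group_add
begin

definition less_eq_br_hom_def: "S \<le> T \<longleftrightarrow> (\<forall>x\<ge>0. br_apply S x \<le> br_apply T x)"
definition less_br_hom_def: "S < T \<longleftrightarrow> S \<le> T \<and> \<not> T \<le> (S :: 'a br_hom)"

instance
proof
  fix S T R :: "'a br_hom"
  show "S < T \<longleftrightarrow> S \<le> T \<and> \<not> T \<le> S" by (rule less_br_hom_def)
  show "S \<le> S" by (simp add: less_eq_br_hom_def)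
  show "S \<le> T \<Longrightarrow> T \<le> R \<Longrightarrow> S \<le> R"
    unfolding less_eq_br_hom_def by (meson order_trans)
  show "S \<le> T \<Longrightarrow> R + S \<le> R + T"
    by (simp add: less_eq_br_hom_def br_apply_plus)
  assume "S \<le> T" "T \<le> S"
  then have eq: "br_apply S x = br_apply T x" if "0 \<le> x" for x
    using that unfolding less_eq_br_hom_def by (simp add: order_antisym)
  show "S = T"
  proof (rule br_hom_eqI)
    fix x :: 'a
    have x: "x = pprt x - (- nprt x)" using prts[of x] by simp
    have "br_apply S (pprt x) = br_apply T (pprt x)" by (rule eq) simp
    moreover have "br_apply S (- nprt x) = br_apply T (- nprt x)" by (rule eq) simp
    ultimately show "br_apply S x = br_apply T x"
      by (subst (1 2) x) (simp only: br_apply_minus_right)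
  qed
qed

end

text \<open>The topology of uniform convergence on bounded sets; lemma \<open>tendsto_br_hom_iff\<close> confirms
  that it has the intended convergence.\<close>

definition br_ball :: "'a::locally_solid_l_ring br_hom \<Rightarrow> 'a set \<Rightarrow> 'a set \<Rightarrow> 'a br_hom set"
  where "br_ball S B V = {T. br_apply (T - S) ` B \<subseteq> V}"

instantiation br_hom :: (locally_solid_l_ring) topological_space
begin

definition open_br_hom_def: "open (\<U> :: 'a br_hom set) \<longleftrightarrow>
  (\<forall>S\<in>\<U>. \<exists>B V. ring_bounded B \<and> nbhd 0 V \<and> br_ball S B V \<subseteq> \<U>)"

instance
proof
  show "open (UNIV :: 'a br_hom set)"
    unfolding open_br_hom_def using ring_bounded_empty nbhd_UNIV by blast
next
  fix \<U> \<V> :: "'a br_hom set" assume o: "open \<U>" "open \<V>"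
  show "open (\<U> \<inter> \<V>)"
    unfolding open_br_hom_def
  proof
    fix S assume S: "S \<in> \<U> \<inter> \<V>"
    obtain B V where 1: "ring_bounded B" "nbhd 0 V" "br_ball S B V \<subseteq> \<U>"
      using o(1) S unfolding open_br_hom_def by blast
    obtain B' V' where 2: "ring_bounded B'" "nbhd 0 V'" "br_ball S B' V' \<subseteq> \<V>"
      using o(2) S unfolding open_br_hom_def by blast
    have "br_ball S (B \<union> B') (V \<inter> V') \<subseteq> \<U> \<inter> \<V>"
      using 1(3) 2(3) unfolding br_ball_def by blast
    then show "\<exists>B V. ring_bounded B \<and> nbhd 0 V \<and> br_ball S B V \<subseteq> \<U> \<inter> \<V>"
      using ring_bounded_Un[OF 1(1) 2(1)] nbhd_Int[OF 1(2) 2(2)] by blast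
  qed
next
  fix \<K> :: "'a br_hom set set" assume "\<forall>\<U>\<in>\<K>. open \<U>"
  then show "open (\<Union>\<K>)"
    unfolding open_br_hom_def by (metis Union_iff Union_upper order_trans)
qed

end

lemma nbhd_br_hom_iff:
  "nbhd S \<N> \<longleftrightarrow> (\<exists>B V. ring_bounded B \<and> nbhd 0 V \<and> br_ball S B V \<subseteq> \<N>)"
proof
  assume "nbhd S \<N>"
  then show "\<exists>B V. ring_bounded B \<and> nbhd 0 V \<and> br_ball S B V \<subseteq> \<N>"
    unfolding nbhd_def open_br_hom_def by (metis order_trans)
next
  assume "\<exists>B V. ring_bounded B \<and> nbhd 0 V \<and> br_ball S B V \<subseteq> \<N>"
  then obtain B V where B: "ring_bounded B" and V: "nbhd 0 V" and sub: "br_ball S B V \<subseteq> \<N>"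
    by blast
  define \<U> where "\<U> = {T. \<exists>W. nbhd 0 W \<and> br_ball T B W \<subseteq> br_ball S B V}"
  have "open \<U>"
    unfolding open_br_hom_def
  proof
    fix T assume "T \<in> \<U>"
    then obtain W where W: "nbhd 0 W" "br_ball T B W \<subseteq> br_ball S B V"
      unfolding \<U>_def by blast
    obtain W' where W': "nbhd 0 W'" "\<forall>x\<in>W'. \<forall>y\<in>W'. x + y \<in> W"
      using W(1) by (rule nbhd_zero_add)
    have "br_ball R B W' \<subseteq> br_ball T B W" if "R \<in> br_ball T B W'" for R
    proof
      fix Q assume Q: "Q \<in> br_ball R B W'"
      have "br_apply (Q - T) b \<in> W" if "b \<in> B" for b
      proof -
        have "br_apply (Q - R) b + br_apply (R - T) b \<in> W"
          using W'(2) Q \<open>R \<in> br_ball T B W'\<close> that unfolding br_ball_def by blast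
        then show ?thesis by (simp add: br_apply_minus)
      qed
      then show "Q \<in> br_ball T B W" unfolding br_ball_def by blast
    qed
    then have "br_ball T B W' \<subseteq> \<U>"
      using W W' unfolding \<U>_def by blast
    then show "\<exists>B V. ring_bounded B \<and> nbhd 0 V \<and> br_ball T B V \<subseteq> \<U>"
      using B W'(1) by blast
  qed
  moreover have "S \<in> \<U>" unfolding \<U>_def using V by blast
  moreover have "\<U> \<subseteq> \<N>"
  proof
    fix T assume "T \<in> \<U>"
    then obtain W where "nbhd 0 W" "br_ball T B W \<subseteq> br_ball S B V"
      unfolding \<U>_def by blast
    moreover from this have "T \<in> br_ball T B W"
      using nbhd_mem by (fastforce simp: br_ball_def br_apply_zero)
    ultimately show "T \<in> \<N>" using sub by blast
  qed
  ultimately show "nbhd S \<N>" unfolding nbhd_def by blast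
qed

lemma tendsto_br_hom_iff:
  fixes S :: "'a::locally_solid_l_ring br_hom"
  shows "(f \<longlongrightarrow> S) F \<longleftrightarrow>
    (\<forall>B V. ring_bounded B \<and> nbhd 0 V \<longrightarrow> eventually (\<lambda>i. br_apply (f i - S) ` B \<subseteq> V) F)"
proof
  assume f: "(f \<longlongrightarrow> S) F"
  show "\<forall>B V. ring_bounded B \<and> nbhd 0 V \<longrightarrow> eventually (\<lambda>i. br_apply (f i - S) ` B \<subseteq> V) F"
  proof (intro allI impI)
    fix B V :: "'a set" assume "ring_bounded B \<and> nbhd 0 V"
    then have "nbhd S (br_ball S B V)" unfolding nbhd_br_hom_iff by blast
    then have "eventually (\<lambda>i. f i \<in> br_ball S B V) F"
      using f unfolding nbhd_iff_eventually filterlim_iff by blast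
    then show "eventually (\<lambda>i. br_apply (f i - S) ` B \<subseteq> V) F"
      by (simp add: br_ball_def)
  qed
next
  assume *: "\<forall>B V. ring_bounded B \<and> nbhd 0 V \<longrightarrow>
    eventually (\<lambda>i. br_apply (f i - S) ` B \<subseteq> V) F"
  show "(f \<longlongrightarrow> S) F"
  proof (rule topological_tendstoI)
    fix \<U> assume "open \<U>" "S \<in> \<U>"
    then obtain B V where "ring_bounded B" "nbhd 0 V" "br_ball S B V \<subseteq> \<U>"
      unfolding open_br_hom_def by blast
    moreover from this have "eventually (\<lambda>i. f i \<in> br_ball S B V) F"
      using * by (simp add: br_ball_def)
    ultimately show "eventually (\<lambda>i. f i \<in> \<U>) F"
      by (auto elim: eventually_mono)
  qed
qed

end

theory Submission
  imports Defs
begin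

text \<open>
  If the operators have the Levi property and \<open>A\<close> is a bounded upward directed set of positive
  elements of the ring, then the multiplications by elements of \<open>A\<close> form a bounded upward
  directed set of positive operators (\<open>ring_bounded_left_mult\<close>). Their supremum \<open>S\<close> dominates
  each of them on the positive cone. The unity is a square and therefore positive, so the value of
  \<open>S\<close> at it is an upper bound of \<open>A\<close>, and order completeness provides the supremum.

  Conversely, let \<open>A\<close> be a bounded upward directed set of positive operators. Composing with
  multiplication operators shows that the values \<open>T b\<close>, for \<open>T\<close> in \<open>A\<close> and \<open>b\<close> in a bounded
  set, form a bounded set of the ring (\<open>ring_bounded_br_apply\<close>). Hence the Levi property
  provides \<open>S x = sup {T x | T \<in> A}\<close> for positive \<open>x\<close>. This is additive on the positive cone
  because \<open>A\<close> is directed, and it extends to a positive group homomorphism that is the supremum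
  of \<open>A\<close> once it is known to be an admissible operator.

  The point is therefore that \<open>S\<close> maps bounded sets to bounded sets. For \<open>b \<ge> 0\<close> in a bounded
  set and small \<open>v\<close>, all \<open>\<bar>v\<bar> * T b\<close> lie in a given solid order closed neighbourhood, and one
  has to pass to the supremum over \<open>T\<close> inside the product with \<open>\<bar>v\<bar>\<close>
  (\<open>fatou_ring_bounded_directed_sups\<close>). So multiplication by a positive \<open>v\<close> must be order
  continuous (\<open>f_ring_mult_order_continuous\<close>). Squares in an f-ring are positive, so
  \<open>(v - n e)\<^sup>2 \<ge> 0\<close> gives \<open>n v \<le> v\<^sup>2 + n\<^sup>2 e\<close>. If \<open>y\<close> decreases to \<open>0\<close> and \<open>z \<le> v y\<close>
  throughout, then \<open>n z \<le> v\<^sup>2 y + n\<^sup>2 y\<close>, whose last term disappears in the limit while the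
  first stays below a fixed \<open>v\<^sup>2 y\<^sub>0\<close>; as \<open>n\<close> is arbitrary and an order complete ring is
  archimedean, \<open>z \<le> 0\<close>.
\<close>

section \<open>Suprema and integer multiples\<close>

lemma isLub_UNIV_iff:
  "isLub UNIV A s \<longleftrightarrow> (\<forall>a\<in>A. a \<le> s) \<and> (\<forall>u. (\<forall>a\<in>A. a \<le> u) \<longrightarrow> s \<le> u)"
  unfolding isLub_def leastP_def isUb_def setle_def setge_def by auto

lemma isGlb_UNIV_iff:
  "isGlb UNIV A s \<longleftrightarrow> (\<forall>a\<in>A. s \<le> a) \<and> (\<forall>u. (\<forall>a\<in>A. u \<le> a) \<longrightarrow> u \<le> s)"
  unfolding isGlb_def greatestP_def isLb_def setle_def setge_def by auto

lemma upward_directed_image: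
  assumes A: "upward_directed A" and f: "mono_on A f"
  shows "upward_directed (f ` A)"
  unfolding upward_directed_def
proof (intro conjI ballI)
  show "f ` A \<noteq> {}" using A by (simp add: upward_directed_def)
  fix x y assume "x \<in> f ` A" "y \<in> f ` A"
  then obtain a b where ab: "a \<in> A" "b \<in> A" "x = f a" "y = f b" by blast
  then obtain c where "c \<in> A" "a \<le> c" "b \<le> c"
    using A unfolding upward_directed_def by blast
  then show "\<exists>z\<in>f ` A. x \<le> z \<and> y \<le> z" using ab mono_onD[OF f] by blast
qed

text \<open>Natural multiples \<open>n x\<close>. The unity of the ring is only assumed to exist and is not the
  constant \<open>1\<close> of a type class, so that \<open>of_nat\<close> cannot express them.\<close>

primrec nmult :: "nat \<Rightarrow> 'a::comm_monoid_add \<Rightarrow> 'a" where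
  "nmult 0 x = 0"
| "nmult (Suc n) x = x + nmult n x"

lemma nmult_nmult: "nmult m (nmult n x) = nmult (m * n) x"
proof -
  have "nmult (k + n) x = nmult k x + nmult n x" for k n
    by (induction k) (simp_all add: add_ac)
  then show ?thesis by (induction m) simp_all
qed

lemma nmult_mult_left: "nmult n x * y = nmult n (x * y :: 'a::ring)"
  by (induction n) (simp_all add: distrib_right)

lemma nmult_mult_right: "x * nmult n y = nmult n (x * y :: 'a::ring)"
  by (induction n) (simp_all add: distrib_left)

lemma nmult_mono: "x \<le> y \<Longrightarrow> nmult n x \<le> nmult n (y :: 'a::ordered_ab_group_add)"
  by (induction n) (auto intro: add_mono)

text \<open>If \<open>s\<close> is the supremum of all multiples of \<open>z\<close>, then \<open>s - z\<close> is an upper bound of them too,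
  because \<open>n z + z\<close> is again a multiple.\<close>

lemma order_complete_archimedean:
  fixes z :: "'a::l_ring"
  assumes oc: "order_complete TYPE('a)" and le: "\<And>n. nmult n z \<le> w"
  shows "z \<le> 0"
proof -
  have "bdd_above (range (\<lambda>n. nmult n z))" using le by (auto intro!: bdd_aboveI)
  then obtain s where "isLub UNIV (range (\<lambda>n. nmult n z)) s"
    using oc unfolding order_complete_def by blast
  then have s: "\<And>n. nmult n z \<le> s" "\<And>u. (\<And>n. nmult n z \<le> u) \<Longrightarrow> s \<le> u"
    unfolding isLub_UNIV_iff by auto
  have "s \<le> s - z"
  proof (rule s(2))
    show "nmult n z \<le> s - z" for n using s(1)[of "Suc n"] by (simp add: algebra_simps)
  qed
  then show "z \<le> 0" by simp
qed

section \<open>Absolute values and squares in f-rings\<close>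

text \<open>The f-ring axiom asks for a strictly positive multiplier; the case \<open>c = 0\<close> holds because
  disjoint elements are positive.\<close>

lemma f_ring_disjoint_mult:
  fixes a b c :: "'a::locally_solid_f_ring"
  assumes "inf a b = 0" "0 \<le> c"
  shows "inf (c * a) b = 0" "inf (a * c) b = 0"
proof -
  have "0 \<le> b" using assms(1) by (metis inf.cobounded2)
  then have "inf 0 b = 0" by (rule inf_absorb1)
  then show "inf (c * a) b = 0" "inf (a * c) b = 0"
    using f_ring[OF assms(1), of c] assms(2) by (cases "c = 0"; simp add: order_less_le)+
qed

lemma inf_sum_eq_zero:
  fixes a b c :: "'a::lattice_ab_group_add"
  assumes "inf a c = 0" "inf b c = 0"
  shows "inf (a + b) c = 0"
proof (rule order.antisym)
  have nn: "0 \<le> a" "0 \<le> b" "0 \<le> c"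
    using assms by (metis inf.cobounded1 inf.cobounded2)+
  have "inf (a + b) c \<le> inf (a + b) (c + b)"
    using nn by (intro inf_mono) auto
  also have "\<dots> = b" using assms by (simp flip: add_inf_distrib_right)
  finally have "inf (a + b) c \<le> inf b c" by simp
  then show "inf (a + b) c \<le> 0" using assms by simp
  show "0 \<le> inf (a + b) c" using nn by simp
qed

lemma abs_diff_disjoint:
  fixes a b :: "'a::lattice_ab_group_add_abs"
  assumes "inf a b = 0"
  shows "\<bar>a - b\<bar> = a + b"
proof -
  have "a + b = sup a b" using add_eq_inf_sup[of a b] assms by simp
  moreover have "\<bar>a - b\<bar> = sup a b - inf a b"
  proof -
    have "sup a b - inf a b = sup a b + sup (-a) (-b)"
      by (simp add: neg_inf_eq_sup diff_conv_add_uminus)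
    also have "\<dots> = sup (sup (a + - a) (b + - a)) (sup (a + - b) (b + - b))"
      by (simp only: add_sup_distrib_left add_sup_distrib_right)
    also have "\<dots> = sup (sup (a - b) (b - a)) 0"
      by (simp add: sup_commute sup_left_commute sup_assoc)
    also have "\<dots> = \<bar>a - b\<bar>"
      using abs_ge_zero[of "a - b"] by (simp add: abs_lattice sup_absorb1)
    finally show ?thesis by simp
  qed
  ultimately show ?thesis using assms by simp
qed

lemma inf_pprt_nprt: "inf (pprt x) (- nprt x) = (0 :: 'a::lattice_ab_group_add)"
proof -
  have "inf (pprt x) (- nprt x) = inf (x - nprt x) (0 - nprt x)"
    using prts[of x] by (metis add_diff_cancel_right' diff_0)
  also have "\<dots> = inf x 0 - nprt x"
    by (simp only: diff_conv_add_uminus add_inf_distrib_right)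
  finally show ?thesis by (simp add: nprt_def)
qed

text \<open>Among the four products of the positive and negative parts of \<open>x\<close> and \<open>y\<close>, the two that
  enter \<open>x * y\<close> with a plus sign are disjoint from the two that enter with a minus sign, so
  taking the absolute value of the difference turns it into the sum.\<close>

lemma f_ring_abs_mult: "\<bar>x * y\<bar> = \<bar>x\<bar> * \<bar>y :: 'a::locally_solid_f_ring\<bar>"
proof -
  define a b c d where "a = pprt x" "b = - nprt x" "c = pprt y" "d = - nprt y"
  have nn: "0 \<le> a" "0 \<le> b" "0 \<le> c" "0 \<le> d" by (simp_all add: a_b_c_d_def)
  have dis: "inf a b = 0" "inf c d = 0" by (simp_all add: a_b_c_d_def inf_pprt_nprt)
  have eqs: "x = a - b" "y = c - d" "\<bar>x\<bar> = a + b" "\<bar>y\<bar> = c + d"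
    using prts[of x] prts[of y] by (simp_all add: a_b_c_d_def abs_prts)
  have "inf (a * c) (a * d) = 0" "inf (b * d) (b * c) = 0"
    "inf (a * c) (b * c) = 0" "inf (b * d) (a * d) = 0"
    using dis nn by (metis f_ring_disjoint_mult inf_commute)+
  then have "inf (a * c + b * d) (a * d) = 0" "inf (a * c + b * d) (b * c) = 0"
    by (simp_all add: inf_sum_eq_zero)
  then have "inf (a * c + b * d) (a * d + b * c) = 0"
    by (metis inf_sum_eq_zero inf_commute)
  from abs_diff_disjoint[OF this]
  have "\<bar>a * c + b * d - (a * d + b * c)\<bar> = a * c + b * d + (a * d + b * c)" .
  moreover have "x * y = a * c + b * d - (a * d + b * c)"
    unfolding eqs(1,2) by (simp add: algebra_simps)
  moreover have "\<bar>x\<bar> * \<bar>y\<bar> = a * c + b * d + (a * d + b * c)"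
    unfolding eqs(3,4) by (simp add: algebra_simps)
  ultimately show ?thesis by simp
qed

text \<open>The positive and the negative part annihilate each other: multiplying one of two disjoint
  elements by a positive element keeps them disjoint, so \<open>a * b\<close> is disjoint from itself. Hence
  the mixed terms of the square vanish.\<close>

lemma f_ring_square_nonneg: "0 \<le> x * (x :: 'a::locally_solid_f_ring)"
proof -
  define a b where "a = pprt x" "b = - nprt x"
  have nn: "0 \<le> a" "0 \<le> b" by (simp_all add: a_b_def)
  have dis: "inf a b = 0" "inf b a = 0" using inf_pprt_nprt[of x] by (simp_all add: a_b_def inf_commute)
  have "a * b = 0" "b * a = 0"
    using f_ring_disjoint_mult(1)[OF _ nn(1)] f_ring_disjoint_mult(2)[OF _ nn(1)]
      f_ring_disjoint_mult(2)[OF _ nn(2)] f_ring_disjoint_mult(1)[OF _ nn(2)] dis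
    by (metis inf_commute inf.idem)+
  moreover have x: "x = a - b" using prts[of x] by (simp add: a_b_def)
  ultimately have "x * x = a * a + b * b" unfolding x by (simp add: algebra_simps)
  then show ?thesis using nn by (simp add: mult_nonneg)
qed

lemma f_ring_unit_nonneg:
  fixes e :: "'a::locally_solid_f_ring"
  assumes e: "\<And>x. e * x = x" "\<And>x. x * e = x"
  shows "0 \<le> e"
  using f_ring_square_nonneg[of e] e by simp

section \<open>Order continuity of multiplication\<close>

definition decreases_to_zero :: "'a::{order,zero} set \<Rightarrow> bool"
  where "decreases_to_zero D \<longleftrightarrow>
    D \<noteq> {} \<and> (\<forall>x\<in>D. \<forall>y\<in>D. \<exists>z\<in>D. z \<le> x \<and> z \<le> y) \<and> isGlb UNIV D 0"

text \<open>Natural multiples of a set that decreases to \<open>0\<close> disappear in the infimum. In the induction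
  step the \<open>n + 1\<close> copies of \<open>y\<close> are moved to different members of the set, which
  directedness allows, so that one copy can be kept fixed while the others vanish.\<close>

lemma decreases_to_zero_add_nmult:
  fixes w :: "'a::l_ring"
  assumes D: "decreases_to_zero D" and w: "\<And>y. y \<in> D \<Longrightarrow> w \<le> c + nmult n y"
  shows "w \<le> c"
  using w
proof (induction n arbitrary: c)
  case 0
  then show ?case using D by (auto simp: decreases_to_zero_def)
next
  case (Suc n)
  have "w \<le> c + y" if y: "y \<in> D" for y
  proof (rule Suc.IH)
    fix y' assume "y' \<in> D"
    then obtain u where u: "u \<in> D" "u \<le> y" "u \<le> y'"
      using D y unfolding decreases_to_zero_def by blast
    have "w \<le> c + nmult (Suc n) u" by (rule Suc.prems[OF u(1)])
    also have "\<dots> \<le> c + y + nmult n y'"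
      using add_mono[OF u(2) nmult_mono[OF u(3), of n]] by (simp add: add.assoc)
    finally show "w \<le> c + y + nmult n y'" .
  qed
  then have "\<forall>y\<in>D. w - c \<le> y" by (simp add: algebra_simps)
  then have "w - c \<le> 0" using D unfolding decreases_to_zero_def isGlb_UNIV_iff by blast
  then show ?case by simp
qed

text \<open>A map that is dominated by a multiple of the identity is order continuous; here the domination
  has an error \<open>N y / n\<close> with \<open>n\<close> at choice. For a lower bound \<open>z\<close> of the image, the multiple
  of the identity vanishes in the infimum, and what remains is \<open>n z \<le> N y\<^sub>0\<close> for all \<open>n\<close>, with
  a fixed \<open>y\<^sub>0\<close> in \<open>D\<close>.\<close>

lemma decreases_to_zero_image:
  fixes M N :: "'a::l_ring \<Rightarrow> 'a"
  assumes oc: "order_complete TYPE('a)"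
    and M: "mono M" "M 0 = 0" and N: "mono N"
    and bound: "\<And>n y. 0 \<le> y \<Longrightarrow> nmult n (M y) \<le> N y + nmult (m n) y"
    and D: "decreases_to_zero D"
  shows "decreases_to_zero (M ` D)"
  unfolding decreases_to_zero_def isGlb_UNIV_iff
proof (intro conjI allI impI)
  have nn: "0 \<le> y" if "y \<in> D" for y
    using D that unfolding decreases_to_zero_def isGlb_UNIV_iff by blast
  obtain y0 where y0: "y0 \<in> D" using D unfolding decreases_to_zero_def by blast
  then show "M ` D \<noteq> {}" by blast
  show "\<forall>x\<in>M ` D. \<forall>y\<in>M ` D. \<exists>z\<in>M ` D. z \<le> x \<and> z \<le> y"
  proof (intro ballI, elim imageE)
    fix a b x y assume "a = M x" "b = M y" "x \<in> D" "y \<in> D"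
    moreover from this obtain z where "z \<in> D" "z \<le> x" "z \<le> y"
      using D unfolding decreases_to_zero_def by blast
    ultimately show "\<exists>z\<in>M ` D. z \<le> a \<and> z \<le> b" using monoD[OF M(1)] by blast
  qed
  show "\<forall>a\<in>M ` D. 0 \<le> a" using nn monoD[OF M(1), of 0] M(2) by auto
  fix z assume z: "\<forall>a\<in>M ` D. z \<le> a"
  have "nmult n z \<le> N y0" for n
  proof (rule decreases_to_zero_add_nmult[OF D])
    fix y assume "y \<in> D"
    then obtain u where u: "u \<in> D" "u \<le> y0" "u \<le> y"
      using D y0 unfolding decreases_to_zero_def by blast
    have "nmult n z \<le> nmult n (M u)" using z u(1) by (intro nmult_mono) auto
    also have "\<dots> \<le> N u + nmult (m n) u" by (rule bound[OF nn[OF u(1)]])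
    also have "\<dots> \<le> N y0 + nmult (m n) y"
      using u(2,3) by (intro add_mono monoD[OF N] nmult_mono)
    finally show "nmult n z \<le> N y0 + nmult (m n) y" .
  qed
  then show "z \<le> 0" by (rule order_complete_archimedean[OF oc])
qed

text \<open>Expanding \<open>(v - n e)\<^sup>2 \<ge> 0\<close> bounds \<open>2 n v\<close>, and \<open>n v\<close> is smaller as \<open>v\<close> is positive.\<close>

lemma f_ring_nmult_le_square:
  fixes v e :: "'a::locally_solid_f_ring"
  assumes e: "\<And>x. e * x = x" "\<And>x. x * e = x" and v: "0 \<le> v"
  shows "nmult n v \<le> v * v + nmult (n * n) e"
proof -
  define q where "q = nmult n e"
  have q: "v * q = nmult n v" "q * v = nmult n v" "q * q = nmult (n * n) e"
    by (simp_all add: q_def nmult_mult_left nmult_mult_right nmult_nmult e)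
  have "0 \<le> (v - q) * (v - q)" by (rule f_ring_square_nonneg)
  also have "\<dots> = v * v + q * q - (v * q + q * v)" by (simp add: algebra_simps)
  finally have "nmult n v + nmult n v \<le> v * v + nmult (n * n) e" by (simp add: q)
  moreover have "0 \<le> nmult n v"
  proof -
    have "nmult n (0::'a) = 0" by (induction n) auto
    then show ?thesis using nmult_mono[OF v, of n] by simp
  qed
  ultimately show ?thesis by (meson add_increasing order_refl order_trans)
qed

lemma f_ring_mult_order_continuous:
  fixes v e :: "'a::locally_solid_f_ring"
  assumes oc: "order_complete TYPE('a)"
    and e: "\<And>x. e * x = x" "\<And>x. x * e = x" and v: "0 \<le> v" and D: "decreases_to_zero D"
  shows "decreases_to_zero ((\<lambda>y. v * y) ` D)" "decreases_to_zero ((\<lambda>y. y * v) ` D)"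
proof -
  have vv: "0 \<le> v * v" by (rule f_ring_square_nonneg)
  have le: "nmult n (v * y) \<le> v * v * y + nmult (n * n) y" (is ?L)
    "nmult n (y * v) \<le> y * (v * v) + nmult (n * n) y" (is ?R) if "0 \<le> y" for n y
  proof -
    show ?L using mult_right_mono[OF f_ring_nmult_le_square[OF e v, of n] that]
      by (simp add: distrib_right nmult_mult_left e)
    show ?R using mult_left_mono[OF f_ring_nmult_le_square[OF e v, of n] that]
      by (simp add: distrib_left nmult_mult_right e)
  qed
  show "decreases_to_zero ((\<lambda>y. v * y) ` D)"
    by (rule decreases_to_zero_image[OF oc _ _ _ _ D, where N = "\<lambda>y. v * v * y" and m = "\<lambda>n. n * n"])
      (use v vv le in \<open>auto intro!: monoI mult_left_mono\<close>)
  show "decreases_to_zero ((\<lambda>y. y * v) ` D)"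
    by (rule decreases_to_zero_image[OF oc _ _ _ _ D, where N = "\<lambda>y. y * (v * v)" and m = "\<lambda>n. n * n"])
      (use v vv le in \<open>auto intro!: monoI mult_right_mono\<close>)
qed

section \<open>Bounded sets\<close>

lemma locally_solid_nbhd:
  fixes W :: "'a::locally_solid_l_ring set"
  assumes "nbhd 0 W"
  obtains V where "nbhd 0 V" "solid V" "V \<subseteq> W"
  using assms locally_solid[where 'a = 'a] unfolding nbhd_basis_def by blast

lemma solid_abs_iff: "solid V \<Longrightarrow> \<bar>x\<bar> \<in> V \<longleftrightarrow> x \<in> V"
  unfolding solid_def by (metis abs_idempotent order_refl)

lemma ring_bounded_mult:
  fixes A B :: "'a::locally_solid_l_ring set"
  assumes A: "ring_bounded A" and B: "ring_bounded B"
  shows "ring_bounded {a * b | a b. a \<in> A \<and> b \<in> B}"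
  unfolding ring_bounded_def
proof (intro allI impI)
  fix W :: "'a set" assume W: "nbhd 0 W"
  obtain U where U: "nbhd 0 U" "\<forall>v\<in>U. \<forall>a\<in>A. v * a \<in> W \<and> a * v \<in> W"
    using A W unfolding ring_bounded_def by blast
  obtain U' where U': "nbhd 0 U'" "\<forall>v\<in>U'. \<forall>b\<in>B. v * b \<in> W \<and> b * v \<in> W"
    using B W unfolding ring_bounded_def by blast
  obtain V where V: "nbhd 0 V" "\<forall>v\<in>V. \<forall>a\<in>A. v * a \<in> U' \<and> a * v \<in> U'"
    using A U'(1) unfolding ring_bounded_def by blast
  obtain V' where V': "nbhd 0 V'" "\<forall>v\<in>V'. \<forall>b\<in>B. v * b \<in> U \<and> b * v \<in> U"
    using B U(1) unfolding ring_bounded_def by blast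
  have "v * (a * b) \<in> W \<and> a * b * v \<in> W" if "v \<in> V \<inter> V'" "a \<in> A" "b \<in> B" for v a b
  proof -
    have "v * a * b \<in> W" "a * (b * v) \<in> W" using U(2) U'(2) V(2) V'(2) that by blast+
    then show ?thesis by (simp add: mult.assoc)
  qed
  then show "\<exists>V. nbhd 0 V \<and>
      (\<forall>v\<in>V. \<forall>c\<in>{a * b | a b. a \<in> A \<and> b \<in> B}. v * c \<in> W \<and> c * v \<in> W)"
    using nbhd_Int[OF V(1) V'(1)] by (intro exI[of _ "V \<inter> V'"]) blast
qed

lemma ring_bounded_singleton: "ring_bounded {x :: 'a::locally_solid_l_ring}"
  unfolding ring_bounded_def
proof (intro allI impI)
  fix W :: "'a set" assume W: "nbhd 0 W"
  have "((\<lambda>v. v * x) \<longlongrightarrow> 0 * x) (nhds 0)" "((\<lambda>v. x * v) \<longlongrightarrow> x * 0) (nhds 0)"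
    by (intro tendsto_intros tendsto_mult filterlim_ident)+
  then obtain U V where "nbhd 0 U" "(\<lambda>v. v * x) ` U \<subseteq> W" "nbhd 0 V" "(\<lambda>v. x * v) ` V \<subseteq> W"
    using W nbhd_tendsto[of "\<lambda>v. v * x" 0 W] nbhd_tendsto[of "\<lambda>v. x * v" 0 W] by auto
  then show "\<exists>V. nbhd 0 V \<and> (\<forall>v\<in>V. \<forall>b\<in>{x}. v * b \<in> W \<and> b * v \<in> W)"
    by (intro exI[of _ "U \<inter> V"]) (auto intro: nbhd_Int)
qed

text \<open>Since \<open>\<bar>v * x\<bar> = \<bar>v\<bar> * \<bar>x\<bar>\<close> in an f-ring, \<open>\<bar>x\<bar> \<le> \<bar>b\<bar>\<close> passes to the products with
  \<open>v\<close>, where a solid neighbourhood absorbs it.\<close>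

lemma ring_bounded_solid_hull:
  fixes B :: "'a::locally_solid_f_ring set"
  assumes B: "ring_bounded B"
  shows "ring_bounded {x. \<exists>b\<in>B. \<bar>x\<bar> \<le> \<bar>b\<bar>}"
  unfolding ring_bounded_def
proof (intro allI impI)
  fix W :: "'a set" assume "nbhd 0 W"
  then obtain U where U: "nbhd 0 U" "solid U" "U \<subseteq> W" by (rule locally_solid_nbhd)
  obtain V where V: "nbhd 0 V" "\<forall>v\<in>V. \<forall>b\<in>B. v * b \<in> U \<and> b * v \<in> U"
    using B U(1) unfolding ring_bounded_def by blast
  have "v * x \<in> U \<and> x * v \<in> U" if "v \<in> V" "b \<in> B" "\<bar>x\<bar> \<le> \<bar>b\<bar>" for v x b
  proof -
    have "\<bar>v * x\<bar> \<le> \<bar>v * b\<bar>" "\<bar>x * v\<bar> \<le> \<bar>b * v\<bar>"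
      using that(3) by (auto simp: f_ring_abs_mult intro: mult_left_mono mult_right_mono)
    then show ?thesis using V(2) that U(2) unfolding solid_def by blast
  qed
  then show "\<exists>V. nbhd 0 V \<and> (\<forall>v\<in>V. \<forall>x\<in>{x. \<exists>b\<in>B. \<bar>x\<bar> \<le> \<bar>b\<bar>}. v * x \<in> W \<and> x * v \<in> W)"
    using V(1) U(3) by (intro exI[of _ V]) blast
qed

text \<open>The values \<open>M d\<close>, indexed by the directed set \<open>D\<close> itself, converge in order to \<open>M s\<close>: the
  error is dominated by \<open>M (s - d)\<close>, and \<open>s - d\<close> decreases to \<open>0\<close>.\<close>

lemma order_closed_isLub_mem:
  fixes M :: "'a::l_ring \<Rightarrow> 'a"
  assumes W: "order_closed W" and M: "additive M" "mono M"
    and cont: "\<And>E. decreases_to_zero E \<Longrightarrow> decreases_to_zero (M ` E)"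
    and D: "upward_directed D" "isLub UNIV D s" and mem: "\<And>d. d \<in> D \<Longrightarrow> M d \<in> W"
  shows "M s \<in> W"
proof (rule order_closedD[OF W])
  have le: "d \<le> s" if "d \<in> D" for d using D(2) that unfolding isLub_UNIV_iff by blast
  have "decreases_to_zero ((\<lambda>d. s - d) ` D)"
    unfolding decreases_to_zero_def isGlb_UNIV_iff
  proof (intro conjI allI impI)
    show "(\<lambda>d. s - d) ` D \<noteq> {}" using D(1) by (simp add: upward_directed_def)
    show "\<forall>x\<in>(\<lambda>d. s - d) ` D. \<forall>y\<in>(\<lambda>d. s - d) ` D. \<exists>z\<in>(\<lambda>d. s - d) ` D. z \<le> x \<and> z \<le> y"
      using D(1) by (simp add: upward_directed_def)
    show "\<forall>a\<in>(\<lambda>d. s - d) ` D. 0 \<le> a" using le by auto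
    fix u assume u: "\<forall>a\<in>(\<lambda>d. s - d) ` D. u \<le> a"
    have "\<forall>d\<in>D. d \<le> s - u" using u by (auto simp: algebra_simps)
    then have "s \<le> s - u" using D(2) unfolding isLub_UNIV_iff by blast
    then show "u \<le> 0" by simp
  qed
  from cont[OF this] have glb: "isGlb UNIV ((\<lambda>d. M (s - d)) ` D) 0"
    by (simp add: decreases_to_zero_def image_image)
  have dir: "directed_index D (\<le>)"
    using D(1) unfolding directed_index_def upward_directed_def by (auto intro: order_trans)
  show "order_convergent D (\<le>) M (M s)"
  proof (rule order_convergentI[OF dir])
    show "net_down_zero D (\<le>) (\<lambda>d. M (s - d))"
      unfolding net_down_zero_def using dir glb by (auto intro!: monoD[OF M(2)] diff_left_mono)
    show "net_dominated D (\<le>) M (M s) D (\<lambda>d. M (s - d))"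
      unfolding net_dominated_def
    proof (intro ballI)
      fix d assume d: "d \<in> D"
      have "\<bar>M d' - M s\<bar> \<le> M (s - d)" if "d' \<in> D" "d \<le> d'" for d'
      proof -
        have "\<bar>M d' - M s\<bar> = M s - M d'"
          using monoD[OF M(2) le[OF that(1)]] by (subst abs_minus_commute) simp
        also have "\<dots> \<le> M s - M d" using monoD[OF M(2) that(2)] by (rule diff_left_mono)
        finally show ?thesis by (simp add: additive.diff[OF M(1)])
      qed
      then show "\<exists>i0\<in>D. \<forall>i\<in>D. i0 \<le> i \<longrightarrow> \<bar>M i - M s\<bar> \<le> M (s - d)" using d by blast
    qed
  qed
qed (rule mem)

text \<open>This is where the Fatou property enters: a neighbourhood that contains all products of \<open>\<bar>v\<bar>\<close>
  with members of a directed set contains the product with their supremum, by order continuity of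
  multiplication and order closedness.\<close>

lemma fatou_ring_bounded_directed_sups:
  fixes C :: "'a::locally_solid_f_ring set"
  assumes oc: "order_complete TYPE('a)" and un: "has_unity TYPE('a)"
    and fatou: "fatou_property TYPE('a)"
    and C: "ring_bounded C" "\<forall>c\<in>C. 0 \<le> c"
  shows "ring_bounded {s. \<exists>D\<subseteq>C. upward_directed D \<and> isLub UNIV D s}"
  unfolding ring_bounded_def
proof (intro allI impI)
  fix W :: "'a set" assume "nbhd 0 W"
  then obtain U where U: "nbhd 0 U" "solid U" "order_closed U" "U \<subseteq> W"
    using fatou unfolding fatou_property_def nbhd_basis_def by blast
  obtain V' where V': "nbhd 0 V'" "\<forall>v\<in>V'. \<forall>c\<in>C. v * c \<in> U \<and> c * v \<in> U"
    using C(1) U(1) unfolding ring_bounded_def by blast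
  obtain V where V: "nbhd 0 V" "solid V" "V \<subseteq> V'" using V'(1) by (rule locally_solid_nbhd)
  obtain e :: 'a where e: "\<And>x. e * x = x" "\<And>x. x * e = x"
    using un unfolding has_unity_def by blast
  have "v * s \<in> U \<and> s * v \<in> U"
    if v: "v \<in> V" and D: "D \<subseteq> C" "upward_directed D" "isLub UNIV D s" for v s D
  proof -
    have v': "\<bar>v\<bar> \<in> V'" using v V solid_abs_iff by blast
    have "0 \<le> s"
    proof -
      obtain d where "d \<in> D" using D(2) unfolding upward_directed_def by blast
      then have "0 \<le> d" "d \<le> s" using C(2) D(1,3) unfolding isLub_UNIV_iff by blast+
      then show ?thesis by (rule order_trans)
    qed
    then have abs: "\<bar>v * s\<bar> = \<bar>v\<bar> * s" "\<bar>s * v\<bar> = s * \<bar>v\<bar>" by (simp_all add: f_ring_abs_mult)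
    have "\<bar>v\<bar> * s \<in> U"
      by (rule order_closed_isLub_mem[OF U(3) _ _ f_ring_mult_order_continuous(1)[OF oc e] D(2,3)])
        (use V'(2) v' D(1) in \<open>auto simp: additive_def distrib_left intro!: monoI mult_left_mono\<close>)
    moreover have "s * \<bar>v\<bar> \<in> U"
      by (rule order_closed_isLub_mem[OF U(3) _ _ f_ring_mult_order_continuous(2)[OF oc e] D(2,3)])
        (use V'(2) v' D(1) in \<open>auto simp: additive_def distrib_right intro!: monoI mult_right_mono\<close>)
    ultimately show ?thesis using abs solid_abs_iff[OF U(2)] by metis
  qed
  then show "\<exists>V. nbhd 0 V \<and> (\<forall>v\<in>V. \<forall>s\<in>{s. \<exists>D\<subseteq>C. upward_directed D \<and> isLub UNIV D s}.
      v * s \<in> W \<and> s * v \<in> W)"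
    using V(1) U(4) by (intro exI[of _ V]) blast
qed

section \<open>Multiplication operators\<close>

text \<open>An order interval lies in a symmetric one, so a bound for \<open>\<bar>T x\<bar>\<close> in terms of a bound for
  \<open>\<bar>x\<bar>\<close> suffices for order boundedness.\<close>

lemma br_homsI:
  fixes T :: "'a::locally_solid_l_ring \<Rightarrow> 'a"
  assumes "additive T" and le: "\<And>x w. \<bar>x\<bar> \<le> w \<Longrightarrow> \<bar>T x\<bar> \<le> p w"
    and "br_bounded_map T"
  shows "T \<in> br_homs"
proof -
  have "order_bounded_map T"
    unfolding order_bounded_map_def order_bounded_set_def
  proof (intro allI impI)
    fix A :: "'a set" assume "\<exists>u v. A \<subseteq> {u..v}"
    then obtain u v where A: "A \<subseteq> {u..v}" by blast
    have "T x \<in> {- p (\<bar>u\<bar> + \<bar>v\<bar>)..p (\<bar>u\<bar> + \<bar>v\<bar>)}" if "x \<in> A" for x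
    proof -
      have ux: "u \<le> x" "x \<le> v" using A that by auto
      have "\<bar>x\<bar> \<le> \<bar>u\<bar> + \<bar>v\<bar>"
      proof (rule abs_leI)
        show "x \<le> \<bar>u\<bar> + \<bar>v\<bar>" using ux(2) abs_ge_self[of v] abs_ge_zero[of u]
          by (meson add_increasing order_trans)
        show "- x \<le> \<bar>u\<bar> + \<bar>v\<bar>" using ux(1) abs_ge_minus_self[of u] abs_ge_zero[of v]
          by (meson add_increasing2 neg_le_iff_le order_trans)
      qed
      from le[OF this] show ?thesis
        by (metis abs_le_D1 abs_le_D2 atLeastAtMost_iff minus_le_iff)
    qed
    then show "\<exists>u v. T ` A \<subseteq> {u..v}" by blast
  qed
  then show ?thesis using assms unfolding br_homs_def by blast
qed

definition left_mult :: "'a::locally_solid_l_ring \<Rightarrow> 'a br_hom"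
  where "left_mult v = Abs_br_hom (\<lambda>x. v * x)"

definition right_mult :: "'a::locally_solid_l_ring \<Rightarrow> 'a br_hom"
  where "right_mult v = Abs_br_hom (\<lambda>x. x * v)"

lemma br_apply_left_mult: "br_apply (left_mult v) x = v * x"
proof -
  have "(\<lambda>x. v * x) \<in> br_homs"
  proof (rule br_homsI)
    show "\<bar>v * x\<bar> \<le> \<bar>v\<bar> * w" if "\<bar>x\<bar> \<le> w" for x w
      using abs_mult_le mult_left_mono[OF that abs_ge_zero] by (rule order_trans)
    show "br_bounded_map (\<lambda>x. v * x)"
      unfolding br_bounded_map_def
    proof (intro allI impI)
      fix B :: "'a set" assume "ring_bounded B"
      from ring_bounded_mult[OF ring_bounded_singleton[of v] this]
      show "ring_bounded ((\<lambda>x. v * x) ` B)" by (rule ring_bounded_subset) auto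
    qed
  qed (simp add: additive_def distrib_left)
  then show ?thesis by (simp add: left_mult_def Abs_br_hom_inverse)
qed

lemma br_apply_right_mult: "br_apply (right_mult v) x = x * v"
proof -
  have "(\<lambda>x. x * v) \<in> br_homs"
  proof (rule br_homsI)
    show "\<bar>x * v\<bar> \<le> w * \<bar>v\<bar>" if "\<bar>x\<bar> \<le> w" for x w
      using abs_mult_le mult_right_mono[OF that abs_ge_zero] by (rule order_trans)
    show "br_bounded_map (\<lambda>x. x * v)"
      unfolding br_bounded_map_def
    proof (intro allI impI)
      fix B :: "'a set" assume "ring_bounded B"
      from ring_bounded_mult[OF this ring_bounded_singleton[of v]]
      show "ring_bounded ((\<lambda>x. x * v) ` B)" by (rule ring_bounded_subset) auto
    qed
  qed (simp add: additive_def distrib_right)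
  then show ?thesis by (simp add: right_mult_def Abs_br_hom_inverse)
qed

lemma nbhd_br_ball: "ring_bounded B \<Longrightarrow> nbhd 0 V \<Longrightarrow> nbhd 0 (br_ball 0 B V)"
  unfolding nbhd_br_hom_iff by blast

text \<open>For an operator \<open>S\<close> that is small on \<open>B\<close>, the composite \<open>a * S b\<close> is small because \<open>A\<close> is
  bounded. The other composite \<open>S (a * b)\<close> requires \<open>S\<close> to be small on the set of products of
  \<open>A\<close> and \<open>B\<close>, which is bounded again.\<close>

lemma ring_bounded_left_mult:
  fixes A :: "'a::locally_solid_l_ring set"
  assumes A: "ring_bounded A"
  shows "ring_bounded (left_mult ` A)"
  unfolding ring_bounded_def
proof (intro allI impI)
  fix \<N> :: "'a br_hom set" assume "nbhd 0 \<N>"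
  then obtain B W where B: "ring_bounded B" and W: "nbhd 0 W" and sub: "br_ball 0 B W \<subseteq> \<N>"
    unfolding nbhd_br_hom_iff by blast
  obtain V where V: "nbhd 0 V" "\<forall>v\<in>V. \<forall>a\<in>A. v * a \<in> W \<and> a * v \<in> W"
    using A W unfolding ring_bounded_def by blast
  define B' where "B' = B \<union> {a * b | a b. a \<in> A \<and> b \<in> B}"
  have "ring_bounded B'"
    unfolding B'_def by (intro ring_bounded_Un B ring_bounded_mult A)
  moreover have "S * left_mult a \<in> \<N> \<and> left_mult a * S \<in> \<N>"
    if S: "S \<in> br_ball 0 B' (V \<inter> W)" and a: "a \<in> A" for S a
  proof -
    have "br_apply S (a * b) \<in> W" "br_apply S b \<in> V" if "b \<in> B" for b
    proof -
      have "b \<in> B'" "a * b \<in> B'" using that a unfolding B'_def by blast+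
      then show "br_apply S (a * b) \<in> W" "br_apply S b \<in> V"
        using S unfolding br_ball_def by (auto simp: image_subset_iff)
    qed
    then have "S * left_mult a \<in> br_ball 0 B W" "left_mult a * S \<in> br_ball 0 B W"
      using a V(2) unfolding br_ball_def
      by (auto simp: br_apply_times br_apply_left_mult)
    then show ?thesis using sub by blast
  qed
  ultimately show "\<exists>\<V>. nbhd 0 \<V> \<and> (\<forall>S\<in>\<V>. \<forall>T\<in>left_mult ` A. S * T \<in> \<N> \<and> T * S \<in> \<N>)"
    using nbhd_br_ball nbhd_Int[OF V(1) W]
    by (intro exI[of _ "br_ball 0 B' (V \<inter> W)"]) blast
qed

text \<open>If \<open>v\<close> is close to \<open>0\<close>, then multiplication by \<open>v\<close> is an operator close to \<open>0\<close>, uniformly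
  on bounded sets. As \<open>A\<close> is bounded, following any \<open>T\<close> in \<open>A\<close> by such a multiplication gives
  an operator that is small on \<open>B\<close>; its values there are \<open>v * T b\<close> or \<open>T b * v\<close>.\<close>

lemma ring_bounded_br_apply:
  fixes A :: "'a::locally_solid_l_ring br_hom set"
  assumes A: "ring_bounded A" and B: "ring_bounded B"
  shows "ring_bounded {br_apply T b | T b. T \<in> A \<and> b \<in> B}"
  unfolding ring_bounded_def
proof (intro allI impI)
  fix W :: "'a set" assume "nbhd 0 W"
  then have "nbhd 0 (br_ball 0 B W)" by (rule nbhd_br_ball[OF B])
  then obtain \<V> where \<V>: "nbhd 0 \<V>" "\<forall>S\<in>\<V>. \<forall>T\<in>A. S * T \<in> br_ball 0 B W"
    using A unfolding ring_bounded_def by blast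
  obtain B' V' where B': "ring_bounded B'" "nbhd 0 V'" "br_ball 0 B' V' \<subseteq> \<V>"
    using \<V>(1) unfolding nbhd_br_hom_iff by blast
  obtain V where V: "nbhd 0 V" "\<forall>v\<in>V. \<forall>b\<in>B'. v * b \<in> V' \<and> b * v \<in> V'"
    using B'(1,2) unfolding ring_bounded_def by blast
  have "v * br_apply T b \<in> W \<and> br_apply T b * v \<in> W" if v: "v \<in> V" and Tb: "T \<in> A" "b \<in> B" for v T b
  proof -
    have "left_mult v \<in> br_ball 0 B' V'" "right_mult v \<in> br_ball 0 B' V'"
      using V(2) v unfolding br_ball_def
      by (auto simp: br_apply_left_mult br_apply_right_mult)
    then have "left_mult v * T \<in> br_ball 0 B W" "right_mult v * T \<in> br_ball 0 B W"
      using \<V>(2) B'(3) Tb by blast+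
    then show ?thesis using Tb unfolding br_ball_def
      by (auto simp: br_apply_times br_apply_left_mult br_apply_right_mult image_subset_iff)
  qed
  then show "\<exists>V. nbhd 0 V \<and>
      (\<forall>v\<in>V. \<forall>c\<in>{br_apply T b | T b. T \<in> A \<and> b \<in> B}. v * c \<in> W \<and> c * v \<in> W)"
    using V(1) by (intro exI[of _ V]) blast
qed

section \<open>Suprema of directed sets of operators\<close>

lemma additive_extension_from_cone:
  fixes g :: "'a::lattice_ab_group_add \<Rightarrow> 'a"
  assumes g: "\<And>x y. 0 \<le> x \<Longrightarrow> 0 \<le> y \<Longrightarrow> g (x + y) = g x + g y"
  shows "additive (\<lambda>x. g (pprt x) - g (- nprt x))"
proof
  fix x y :: 'a
  have "pprt (x + y) + (- nprt x + - nprt y) = - nprt (x + y) + (pprt x + pprt y)"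
    using prts[of x] prts[of y] prts[of "x + y"]
    by (simp add: algebra_simps)
  then have "g (pprt (x + y)) + (g (- nprt x) + g (- nprt y))
      = g (- nprt (x + y)) + (g (pprt x) + g (pprt y))"
    by (metis add_nonneg_nonneg g neg_0_le_iff_le nprt_le_zero zero_le_pprt)
  then show "g (pprt (x + y)) - g (- nprt (x + y))
      = g (pprt x) - g (- nprt x) + (g (pprt y) - g (- nprt y))"
    by (simp add: algebra_simps)
qed

text \<open>Directedness is needed because \<open>s + t\<close> is the supremum of \<open>f i + h j\<close> with independent
  indices; a common upper bound \<open>k\<close> of \<open>i\<close> and \<open>j\<close> reduces this to equal indices.\<close>

lemma directed_isLub_add:
  fixes f h :: "'i::order \<Rightarrow> 'a::ordered_ab_group_add"
  assumes A: "upward_directed A" and mono: "mono_on A f" "mono_on A h"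
    and s: "isLub UNIV (f ` A) s" and t: "isLub UNIV (h ` A) t"
    and u: "isLub UNIV ((\<lambda>i. f i + h i) ` A) u"
  shows "u = s + t"
proof (rule order.antisym)
  have "\<forall>a\<in>(\<lambda>i. f i + h i) ` A. a \<le> s + t"
    using s t unfolding isLub_UNIV_iff by (auto intro: add_mono)
  then show "u \<le> s + t" using u unfolding isLub_UNIV_iff by blast
  have le: "f i \<le> u - h j" if ij: "i \<in> A" "j \<in> A" for i j
  proof -
    obtain k where k: "k \<in> A" "i \<le> k" "j \<le> k"
      using A ij unfolding upward_directed_def by blast
    have "f i + h j \<le> f k + h k"
      by (intro add_mono mono_onD[OF mono(1)] mono_onD[OF mono(2)] k ij)
    also have "\<dots> \<le> u" using u k(1) unfolding isLub_UNIV_iff by blast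
    finally show ?thesis by (simp add: algebra_simps)
  qed
  have "s \<le> u - h j" if "j \<in> A" for j using le[OF _ that] s unfolding isLub_UNIV_iff by auto
  then have "\<forall>j\<in>A. h j \<le> u - s" by (auto simp: algebra_simps)
  then have "t \<le> u - s" using t unfolding isLub_UNIV_iff by auto
  then show "s + t \<le> u" by (simp add: algebra_simps)
qed

lemma levi_br_hom_if_levi:
  assumes oc: "order_complete TYPE('a::locally_solid_f_ring)"
    and un: "has_unity TYPE('a)"
    and fatou: "fatou_property TYPE('a)"
    and levi: "levi_property TYPE('a)"
  shows "levi_property TYPE('a br_hom)"
  unfolding levi_property_def
proof (intro allI impI, elim conjE)
  fix A :: "'a br_hom set"
  assume A: "ring_bounded A" "upward_directed A" "\<forall>T\<in>A. 0 \<le> T"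
  have nn: "0 \<le> br_apply T x" if "T \<in> A" "0 \<le> x" for T x
    using A(3) that unfolding less_eq_br_hom_def by (auto simp: br_apply_zero)
  have mono: "mono_on A (\<lambda>T. br_apply T x)" if "0 \<le> x" for x
    using that by (auto intro!: mono_onI simp: less_eq_br_hom_def)
  have dir: "upward_directed ((\<lambda>T. br_apply T x) ` A)" if "0 \<le> x" for x
    by (rule upward_directed_image[OF A(2) mono[OF that]])
  have "\<exists>s. isLub UNIV ((\<lambda>T. br_apply T x) ` A) s" if x: "0 \<le> x" for x
  proof -
    have "ring_bounded ((\<lambda>T. br_apply T x) ` A)"
      by (rule ring_bounded_subset[OF ring_bounded_br_apply[OF A(1) ring_bounded_singleton[of x]]]) auto
    then show ?thesis using levi dir[OF x] nn x unfolding levi_property_def by auto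
  qed
  then obtain g where g: "\<And>x. 0 \<le> x \<Longrightarrow> isLub UNIV ((\<lambda>T. br_apply T x) ` A) (g x)"
    by metis
  have g_ge: "br_apply T x \<le> g x" if "T \<in> A" "0 \<le> x" for T x
    using g that unfolding isLub_UNIV_iff by blast
  have g_le: "g x \<le> u" if "0 \<le> x" "\<And>T. T \<in> A \<Longrightarrow> br_apply T x \<le> u" for x u
    using g that unfolding isLub_UNIV_iff by blast
  have g_add: "g (x + y) = g x + g y" if "0 \<le> x" "0 \<le> y" for x y
    by (rule directed_isLub_add[OF A(2) mono mono g g])
      (use g[of "x + y"] that in \<open>simp_all add: br_apply_add_right\<close>)
  define s where "s x = g (pprt x) - g (- nprt x)" for x
  have s: "additive s"
    unfolding s_def using g_add by (rule additive_extension_from_cone)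
  have s_pos: "s x = g x" if "0 \<le> x" for x
    using that g_add[of 0 0] by (simp add: s_def)
  have s_nn: "0 \<le> s x" if x: "0 \<le> x" for x
  proof -
    obtain T where "T \<in> A" using A(2) unfolding upward_directed_def by blast
    then show ?thesis using nn g_ge x s_pos by (metis order_trans)
  qed
  have s_mono: "s x \<le> s y" if "x \<le> y" for x y
    using s_nn[of "y - x"] that by (simp add: additive.diff[OF s])
  have s_abs: "\<bar>s x\<bar> \<le> s w" if "\<bar>x\<bar> \<le> w" for x w
  proof (rule abs_leI)
    show "s x \<le> s w" using abs_le_D1[OF that] by (rule s_mono)
    show "- s x \<le> s w" using s_mono[OF abs_le_D2[OF that]] by (simp add: additive.minus[OF s])
  qed
  \<comment> \<open>On the absolute values of a bounded set, \<open>s\<close> takes suprema of directed sets of values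
    of the operators in \<open>A\<close>; the other values are dominated by these.\<close>
  have "br_bounded_map s"
    unfolding br_bounded_map_def
  proof (intro allI impI)
    fix B :: "'a set" assume "ring_bounded B"
    have B: "ring_bounded (abs ` B)"
      by (rule ring_bounded_subset[OF ring_bounded_solid_hull[OF \<open>ring_bounded B\<close>]]) auto
    define C where "C = {br_apply T b | T b. T \<in> A \<and> b \<in> abs ` B}"
    have "ring_bounded C" unfolding C_def by (rule ring_bounded_br_apply[OF A(1) B])
    moreover have "\<forall>c\<in>C. 0 \<le> c" unfolding C_def using nn by auto
    ultimately have "ring_bounded {s. \<exists>D\<subseteq>C. upward_directed D \<and> isLub UNIV D s}"
      by (rule fatou_ring_bounded_directed_sups[OF oc un fatou])
    from ring_bounded_solid_hull[OF this]
    show "ring_bounded (s ` B)"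
    proof (rule ring_bounded_subset, intro subsetI, elim imageE)
      fix y b assume y: "y = s b" and b: "b \<in> B"
      have "(\<lambda>T. br_apply T \<bar>b\<bar>) ` A \<subseteq> C" using b unfolding C_def by blast
      then have "s \<bar>b\<bar> \<in> {s. \<exists>D\<subseteq>C. upward_directed D \<and> isLub UNIV D s}"
        using dir[of "\<bar>b\<bar>"] g[of "\<bar>b\<bar>"] s_pos[of "\<bar>b\<bar>"] by auto
      moreover have "\<bar>y\<bar> \<le> \<bar>s \<bar>b\<bar>\<bar>"
        using s_abs[OF order_refl, of b] s_nn[of "\<bar>b\<bar>"] y by simp
      ultimately show "y \<in> {x. \<exists>b\<in>{s. \<exists>D\<subseteq>C. upward_directed D \<and> isLub UNIV D s}. \<bar>x\<bar> \<le> \<bar>b\<bar>}"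
        by blast
    qed
  qed
  with s s_abs have "s \<in> br_homs" by (intro br_homsI)
  then have app: "br_apply (Abs_br_hom s) x = s x" for x by (simp add: Abs_br_hom_inverse)
  have "isLub UNIV A (Abs_br_hom s)"
    unfolding isLub_UNIV_iff less_eq_br_hom_def using g_ge g_le by (simp add: app s_pos)
  then show "\<exists>S. isLub UNIV A S" by blast
qed

lemma levi_if_levi_br_hom:
  assumes oc: "order_complete TYPE('a::locally_solid_f_ring)"
    and un: "has_unity TYPE('a)"
    and levi: "levi_property TYPE('a br_hom)"
  shows "levi_property TYPE('a)"
  unfolding levi_property_def
proof (intro allI impI, elim conjE)
  fix A :: "'a set"
  assume A: "ring_bounded A" "upward_directed A" "\<forall>a\<in>A. 0 \<le> a"
  obtain e :: 'a where e: "\<And>x. e * x = x" "\<And>x. x * e = x"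
    using un unfolding has_unity_def by blast
  have le: "left_mult a \<le> left_mult b" if "a \<le> b" for a b :: 'a
    using that by (simp add: less_eq_br_hom_def br_apply_left_mult mult_right_mono)
  have "upward_directed (left_mult ` A)"
    by (rule upward_directed_image[OF A(2)]) (auto intro!: mono_onI le)
  moreover have "\<forall>T\<in>left_mult ` A. 0 \<le> T"
    using A(3) by (auto simp: less_eq_br_hom_def br_apply_left_mult br_apply_zero mult_nonneg)
  ultimately obtain S where S: "isLub UNIV (left_mult ` A) S"
    using levi ring_bounded_left_mult[OF A(1)] unfolding levi_property_def by blast
  have "a \<le> br_apply S e" if "a \<in> A" for a
  proof -
    have "left_mult a \<le> S" using S that unfolding isLub_UNIV_iff by blast
    then have "br_apply (left_mult a) e \<le> br_apply S e"
      using f_ring_unit_nonneg[OF e] unfolding less_eq_br_hom_def by blast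
    then show ?thesis by (simp add: br_apply_left_mult e)
  qed
  then have "bdd_above A" by (rule bdd_aboveI)
  moreover have "A \<noteq> {}" using A(2) by (simp add: upward_directed_def)
  ultimately show "\<exists>s. isLub UNIV A s" using oc unfolding order_complete_def by blast
qed

theorem theorem3:
  assumes "order_complete TYPE('a::locally_solid_f_ring)"
    and "has_unity TYPE('a)"
    and "fatou_property TYPE('a)"
    and "singletons_group_bounded TYPE('a)"
  shows "levi_property TYPE('a br_hom) \<longleftrightarrow> levi_property TYPE('a)"
  using levi_br_hom_if_levi[OF assms(1-3)] levi_if_levi_br_hom[OF assms(1,2)] by blast

end
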